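(* Let $\mathcal{P}$ be a set of primes and let $$W_{\mathcal{P}}=\{n\in\mathbb{N}: \text{for every } p\in\mathcal{P},\ p\mid n\Rightarrow p^2\mid n\}.$$ Let $a_0$ be a nonnegative integer and $a_1,\dots,a_d\in[N]$ positive integers such that the Hilbert cube $H(a_0;a_1,\dots,a_d)$ is contained in $W_{\mathcal{P}}$. (a) If there exist constants $C,C'>1$ such that $\sum_{p\le C\log N,\,p\in\mathcal{P}}\log p\ge C'\log N$, then $d\ll\frac{C(C'+1)}{C'-1}\log N$, with an absolute implied constant. (b) If the $a_i$ are distinct and there exist constants $C,C'>0$ such that $$\sum_{p\le C\log N,\,p\in\mathcal{P}}\log p>2\log N\quad\text{and}\quad\sum_{C\log N<p\le(\log N)^{1.5},\,p\in\mathcal{P}}\frac{\log p}{p}\ge C'\log\log N,$$ then $d\ll\frac{\log N}{C'\log\log N}$, with an absolute implied constant.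
   Context: $p$ denotes primes. For $a_0\ge0$ and positive integers $a_1,\dots,a_d$, the Hilbert cube is $H(a_0;a_1,\dots,a_d)=a_0+\{0,a_1\}+\cdots+\{0,a_d\}$ when $a_0>0$, and $H(0;a_1,\dots,a_d)$ is the set of nonempty subsums $\{\sum_i\varepsilon_ia_i:\varepsilon_i\in\{0,1\},\sum_i\varepsilon_i>0\}$. $[N]=\{1,\dots,N\}$. $X\ll Y$ means $|X|\le cY$ for an absolute constant $c$. *)

theory Defs
  imports Complex_Main "HOL-Computational_Algebra.Primes"
begin

(* For a0 = 0 the empty subsum is left out, so that the cube consists of positive
   integers also in that case. *)
definition hilbert_cube :: "nat \<Rightarrow> nat \<Rightarrow> (nat \<Rightarrow> nat) \<Rightarrow> nat set" where
  "hilbert_cube a0 d a =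
    (if a0 > 0
     then {a0 + (\<Sum>i=1..d. \<epsilon> i * a i) | \<epsilon>. \<forall>i\<in>{1..d}. \<epsilon> i \<in> {0, 1}}
     else {(\<Sum>i=1..d. \<epsilon> i * a i) | \<epsilon>.
             (\<forall>i\<in>{1..d}. \<epsilon> i \<in> {0, 1}) \<and> (\<Sum>i=1..d. \<epsilon> i) > 0})"

definition W_set :: "nat set \<Rightarrow> nat set" where
  "W_set P = {n. n > 0 \<and> (\<forall>p\<in>P. p dvd n \<longrightarrow> p\<^sup>2 dvd n)}"

end

theory Submission
  imports Defs "HOL-Number_Theory.Cong" "HOL-Analysis.Convex"
begin

text \<open>
  Let \<open>p \<in> P\<close>. If disjoint sets \<open>R\<close>, \<open>T\<close> of generators both have all residues modulo \<open>p\<close> as subset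
  sums, then two subset sums over \<open>T\<close> that agree modulo \<open>p\<close> agree modulo \<open>p\<^sup>2\<close> (complete them by a sum
  over \<open>R\<close> to multiples of \<open>p\<close> in the cube), which is impossible as soon as one more generator is
  prime to \<open>p\<close>. Hence at most \<open>2 * p\<close> generators are prime to \<open>p\<close>, and (a) follows by comparing
  \<open>\<Sum>p. ln p * card {i. p dvd a i}\<close> with \<open>d * ln N\<close>.

  For (b), \<open>m\<close> generators prime to \<open>p\<close> cannot be spread over more than about \<open>p / m\<close> classes modulo
  \<open>p\<close>: by Olson's argument (subadditivity of \<open>\<bar>(B + x) - B\<bar>\<close> and Cauchy--Davenport) a greedy choice
  would gain about \<open>p / m\<close> new subset sums per step and produce such \<open>R\<close> and \<open>T\<close>. So of the order of
  \<open>d ^ 3 / p\<close> pairs \<open>i \<noteq> j\<close> satisfy \<open>a i \<equiv> a j\<close> modulo \<open>p\<close>, and since the \<open>a i\<close> are distinct, Gallagher's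
  larger sieve bounds \<open>\<Sum>p. ln p * (d ^ 3 / p)\<close> by \<open>d\<^sup>2 * ln N\<close>.
\<close>

section \<open>Sumsets modulo a prime\<close>

definition translate_mod :: "int \<Rightarrow> int \<Rightarrow> int set \<Rightarrow> int set" where
  "translate_mod n c A = (\<lambda>x. (x + c) mod n) ` A"

definition plus_mod :: "int \<Rightarrow> int set \<Rightarrow> int set \<Rightarrow> int set" where
  "plus_mod n A B = (\<lambda>(x, y). (x + y) mod n) ` (A \<times> B)"

lemma plus_modI: "x \<in> A \<Longrightarrow> y \<in> B \<Longrightarrow> (x + y) mod n \<in> plus_mod n A B"
  by (auto simp: plus_mod_def)

lemma plus_modE:
  assumes "z \<in> plus_mod n A B"
  obtains x y where "x \<in> A" "y \<in> B" "z = (x + y) mod n"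
  using assms by (auto simp: plus_mod_def)

lemma translate_mod_subset: "n > 0 \<Longrightarrow> translate_mod n c A \<subseteq> {0..<n}"
  by (auto simp: translate_mod_def)

lemma plus_mod_subset: "n > 0 \<Longrightarrow> plus_mod n A B \<subseteq> {0..<n}"
  by (auto simp: plus_mod_def)

lemma inj_on_translate_mod:
  fixes n :: int
  assumes "A \<subseteq> {0..<n}"
  shows "inj_on (\<lambda>x. (x + c) mod n) A"
proof (rule inj_onI)
  fix x y assume xy: "x \<in> A" "y \<in> A" "(x + c) mod n = (y + c) mod n"
  then have "x mod n = y mod n"
    using mod_diff_cong[of "x + c" n "y + c" c c] by simp
  moreover have "x mod n = x" "y mod n = y"
    using assms xy by auto
  ultimately show "x = y" by simp
qed

lemma card_translate_mod:
  assumes "A \<subseteq> {0..<n}"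
  shows "card (translate_mod n c A) = card A"
  unfolding translate_mod_def by (rule card_image[OF inj_on_translate_mod[OF assms]])

text \<open>Stepping by the unit \<open>c\<close> from one element of \<open>A\<close> visits every
  residue, since \<open>c\<close> has an inverse modulo \<open>p\<close>.\<close>

lemma translate_closed_imp_full:
  fixes p c :: int
  assumes p: "prime p" and c: "\<not> p dvd c" and A: "A \<subseteq> {0..<p}" "A \<noteq> {}"
    and closed: "\<And>x. x \<in> A \<Longrightarrow> (x + c) mod p \<in> A"
  shows "A = {0..<p}"
proof -
  have p0: "p > 0" using p by (simp add: prime_gt_0_int)
  obtain x where x: "x \<in> A" using A by blast
  have iter: "(x + int k * c) mod p \<in> A" for k
  proof (induction k)
    case 0
    have "x mod p = x" using x A by auto
    then show ?case using x by simp
  next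
    case (Suc k)
    from closed[OF Suc] show ?case by (simp add: mod_simps algebra_simps)
  qed
  have "coprime c p" using prime_imp_coprime[OF p c] by (simp add: coprime_commute)
  then obtain v where v: "[c * v = 1] (mod p)"
    using cong_solve_coprime_int by blast
  have "y \<in> A" if y: "y \<in> {0..<p}" for y
  proof -
    define k where "k = nat ((v * (y - x)) mod p)"
    have k: "int k = (v * (y - x)) mod p" using p0 by (simp add: k_def)
    have "[int k * c = (v * (y - x)) * c] (mod p)"
      unfolding k by (simp add: cong_def mod_simps)
    also have "(v * (y - x)) * c = (c * v) * (y - x)" by (simp add: algebra_simps)
    also have "[(c * v) * (y - x) = 1 * (y - x)] (mod p)"
      using v by (rule cong_scalar_right)
    finally have "[x + int k * c = x + 1 * (y - x)] (mod p)"
      by (intro cong_add cong_refl)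
    then have "(x + int k * c) mod p = y mod p" by (simp add: cong_def)
    also have "y mod p = y" using y by auto
    finally show ?thesis using iter[of k] by simp
  qed
  then show ?thesis using A by blast
qed

text \<open>Dyson's transform: a translate \<open>B'\<close> of \<open>B\<close> meets \<open>A\<close> without being contained in it, and
  \<open>(A \<union> B', A \<inter> B')\<close> has the same total size and a smaller second component.\<close>
theorem cauchy_davenport:
  fixes p :: int
  assumes p: "prime p"
  shows "A \<subseteq> {0..<p} \<Longrightarrow> B \<subseteq> {0..<p} \<Longrightarrow> A \<noteq> {} \<Longrightarrow> B \<noteq> {} \<Longrightarrow>
    min (nat p) (card A + card B - 1) \<le> card (plus_mod p A B)"
proof (induction "card B" arbitrary: A B rule: less_induct)
  case less
  note A = less.prems(1) and B = less.prems(2)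
  have p0: "p > 0" using p by (simp add: prime_gt_0_int)
  have fin: "finite A" "finite B" using A B finite_subset by blast+
  have fin_sum: "finite (plus_mod p C D)" for C D
    using plus_mod_subset[OF p0] finite_subset by blast
  obtain b where b: "b \<in> B" using less.prems by blast
  have transl: "translate_mod p b A \<subseteq> plus_mod p A B"
    using b by (auto simp: translate_mod_def intro: plus_modI)
  have card_A: "card A \<le> card (plus_mod p A B)"
    using card_mono[OF fin_sum transl] card_translate_mod[OF A] by simp
  show ?case
  \<comment> \<open>In both exceptional cases the translate of \<open>A\<close> by \<open>b\<close>
    already has the required size.\<close>
  proof (cases "B = {b} \<or> A = {0..<p}")
    case True
    then show ?thesis using card_A by auto
  next
    case False
    then obtain b' where b': "b' \<in> B" "b' \<noteq> b" using b by blast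
    define c where "c = b' - b"
    have "\<not> p dvd c"
    proof
      assume "p dvd c"
      then have "b' mod p = b mod p" by (simp add: c_def mod_eq_dvd_iff)
      moreover have "b' mod p = b'" "b mod p = b" using b b' B by auto
      ultimately show False using b' by simp
    qed
    then obtain a where a: "a \<in> A" "(a + c) mod p \<notin> A"
      using translate_closed_imp_full[OF p _ A, of c] less.prems False by blast
    \<comment> \<open>The shift sends \<open>b\<close> to \<open>a\<close>, which is in
      \<open>A\<close>, and \<open>b'\<close> to \<open>(a + c) mod p\<close>, which is not; so
      \<open>A \<inter> B'\<close> is nonempty and proper in \<open>B'\<close>.\<close>
    define e where "e = a - b"
    define B' where "B' = translate_mod p e B"
    have B'sub: "B' \<subseteq> {0..<p}" unfolding B'_def by (rule translate_mod_subset[OF p0])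
    have finB': "finite B'" using B'sub finite_subset by blast
    have card_B': "card B' = card B" unfolding B'_def by (rule card_translate_mod[OF B])
    have "(b + e) mod p = a" using a A by (auto simp: e_def)
    then have a_B': "a \<in> B'" using b unfolding B'_def translate_mod_def by force
    have "(b' + e) mod p = (a + c) mod p" by (simp add: e_def c_def algebra_simps)
    then have "(a + c) mod p \<in> B'" using b' unfolding B'_def translate_mod_def by force
    then have "A \<inter> B' \<subset> B'" using a by blast
    then have lt: "card (A \<inter> B') < card B"
      using psubset_card_mono[OF finB'] card_B' by simp
    have "min (nat p) (card (A \<union> B') + card (A \<inter> B') - 1) \<le> card (plus_mod p (A \<union> B') (A \<inter> B'))"
      by (rule less.hyps[OF lt]) (use A B'sub a a_B' in auto)
    moreover have "card (A \<union> B') + card (A \<inter> B') = card A + card B"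
      using card_Un_Int[OF fin(1) finB'] card_B' by simp
    \<comment> \<open>When \<open>x\<close> comes from \<open>B'\<close>, the summands swap roles:
      the other one lies in \<open>A \<inter> B'\<close>, hence in \<open>A\<close>.\<close>
    moreover have "plus_mod p (A \<union> B') (A \<inter> B') \<subseteq> translate_mod p e (plus_mod p A B)"
    proof
      fix z assume "z \<in> plus_mod p (A \<union> B') (A \<inter> B')"
      then obtain x y where "x \<in> A" "y \<in> B'" "z = (x + y) mod p"
        by (elim plus_modE) (auto simp: add.commute)
      then obtain y' where "x \<in> A" "y' \<in> B" "z = ((x + y') mod p + e) mod p"
        by (auto simp: B'_def translate_mod_def mod_simps algebra_simps)
      then show "z \<in> translate_mod p e (plus_mod p A B)"
        unfolding translate_mod_def by (auto intro: plus_modI)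
    qed
    moreover have "card (translate_mod p e (plus_mod p A B)) = card (plus_mod p A B)"
      by (rule card_translate_mod[OF plus_mod_subset[OF p0]])
    moreover have "finite (translate_mod p e (plus_mod p A B))"
      using fin_sum unfolding translate_mod_def by simp
    ultimately show ?thesis using card_mono by (metis order_trans)
  qed
qed

text \<open>\<open>card (translate_mod p x B - B)\<close> is subadditive in \<open>x\<close>. By Cauchy--Davenport many small
  values would therefore produce many \<open>x\<close> for which \<open>B\<close> and its translate by \<open>x\<close> share at least
  three quarters of their elements, but there are only \<open>card B ^ 2\<close> pairs in \<open>B\<close>.\<close>
lemma card_small_growth:
  fixes p :: int
  assumes p: "prime p" and B: "B \<subseteq> {0..<p}" and g: "1 \<le> g" "4 * g \<le> card B"
    and half: "2 * card B \<le> nat p"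
  shows "card {x \<in> {0..<p}. card (translate_mod p x B - B) \<le> g} \<le> 12 * g"
proof -
  have p0: "p > 0" using p by (simp add: prime_gt_0_int)
  have finB: "finite B" using B finite_subset by blast
  define X where "X = (\<lambda>t. {x \<in> {0..<p}. card (translate_mod p x B - B) \<le> t})"
  have X_sub: "X t \<subseteq> {0..<p}" for t by (auto simp: X_def)
  have finX: "finite (X t)" for t using X_sub finite_subset by blast
  have tr0: "translate_mod p 0 B = B"
    using B by (force simp: translate_mod_def image_iff)
  have X0: "0 \<in> X t" for t using p0 by (simp add: X_def tr0)
  have fin_tr: "finite (translate_mod p x B)" for x using finB by (simp add: translate_mod_def)
  \<comment> \<open>A new element \<open>b + x + y\<close> either is a shift of the new element
    \<open>b + x\<close>, or \<open>b + x\<close> is still in \<open>B\<close> and it is new for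
    \<open>y\<close>.\<close>
  have subadd: "plus_mod p (X s) (X t) \<subseteq> X (s + t)" for s t
  proof
    fix z assume "z \<in> plus_mod p (X s) (X t)"
    then obtain x y where x: "x \<in> X s" and y: "y \<in> X t" and z: "z = (x + y) mod p"
      by (elim plus_modE)
    have "translate_mod p z B - B \<subseteq>
        translate_mod p y (translate_mod p x B - B) \<union> (translate_mod p y B - B)"
    proof
      fix w assume w: "w \<in> translate_mod p z B - B"
      then obtain b where b: "b \<in> B" "w = ((b + x) mod p + y) mod p"
        by (auto simp: translate_mod_def z mod_simps algebra_simps)
      then show "w \<in> translate_mod p y (translate_mod p x B - B) \<union> (translate_mod p y B - B)"
        using w by (cases "(b + x) mod p \<in> B") (auto simp: translate_mod_def)
    qed
    then have "card (translate_mod p z B - B) \<le>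
        card (translate_mod p y (translate_mod p x B - B) \<union> (translate_mod p y B - B))"
      by (intro card_mono) (use fin_tr in \<open>auto simp: translate_mod_def finB\<close>)
    also have "\<dots> \<le> card (translate_mod p y (translate_mod p x B - B)) + card (translate_mod p y B - B)"
      by (rule card_Un_le)
    also have "card (translate_mod p y (translate_mod p x B - B)) = card (translate_mod p x B - B)"
      by (rule card_translate_mod) (use translate_mod_subset[OF p0] in blast)
    finally show "z \<in> X (s + t)" using x y p0 by (auto simp: X_def z)
  qed
  \<comment> \<open>By subadditivity \<open>X (j * g)\<close> contains the \<open>j\<close>-fold
    sumset of \<open>X g\<close>, and each Cauchy--Davenport step adds
    \<open>card (X g) - 1\<close>.\<close>
  have grow: "min (nat p) (j * (card (X g) - 1) + 1) \<le> card (X (j * g))" for j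
  proof (induction j)
    case 0
    have "card {0::int} \<le> card (X 0)" by (rule card_mono[OF finX]) (use X0 in auto)
    then show ?case by simp
  next
    case (Suc j)
    have "min (nat p) (card (X (j * g)) + card (X g) - 1) \<le> card (plus_mod p (X (j * g)) (X g))"
      by (rule cauchy_davenport[OF p X_sub X_sub]) (use X0 in blast)+
    also have "\<dots> \<le> card (X (Suc j * g))"
      by (rule card_mono[OF finX]) (use subadd[of "j * g" g] in \<open>simp add: add.commute\<close>)
    finally have *: "min (nat p) (card (X (j * g)) + card (X g) - 1) \<le> card (X (Suc j * g))" .
    have "card (X g) \<ge> 1" using X0 finX by (metis One_nat_def Suc_leI card_gt_0_iff empty_iff)
    then show ?case using * Suc by (auto simp: min_def split: if_splits)
  qed
  have upper: "3 * card (X t) \<le> 4 * card B" if t: "4 * t \<le> card B" for t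
  proof -
    have inter: "card B - t \<le> card (translate_mod p x B \<inter> B)" if "x \<in> X t" for x
    proof -
      have "card B = card (translate_mod p x B \<inter> B) + card (translate_mod p x B - B)"
        using card_Int_Diff[OF fin_tr, of x B] card_translate_mod[OF B, of x] by simp
      moreover have "card (translate_mod p x B - B) \<le> t" using that by (simp add: X_def)
      ultimately show ?thesis by linarith
    qed
    \<comment> \<open>Double counting: each \<open>x\<close> in \<open>X t\<close> contributes at
      least \<open>card B - t\<close> pairs, while \<open>(x, b) \<mapsto> (b, b + x)\<close> embeds
      \<open>E\<close> into \<open>B \<times> B\<close>.\<close>
    define E where "E = Sigma (X t) (\<lambda>x. {b \<in> B. (b + x) mod p \<in> B})"
    have im: "translate_mod p x B \<inter> B = (\<lambda>b. (b + x) mod p) ` {b \<in> B. (b + x) mod p \<in> B}" for x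
      by (auto simp: translate_mod_def)
    have card_fib: "card {b \<in> B. (b + x) mod p \<in> B} = card (translate_mod p x B \<inter> B)" for x
      unfolding im by (rule card_image[symmetric], rule inj_on_translate_mod) (use B in auto)
    have "card E = (\<Sum>x\<in>X t. card (translate_mod p x B \<inter> B))"
      unfolding E_def by (subst card_SigmaI) (use finX finB card_fib in auto)
    then have "card (X t) * (card B - t) \<le> card E"
      using sum_mono[of "X t" "\<lambda>_. card B - t" "\<lambda>x. card (translate_mod p x B \<inter> B)"] inter by simp
    also have "card E \<le> card (B \<times> B)"
    proof (rule card_inj_on_le[where f = "\<lambda>(x, b). (b, (b + x) mod p)"])
      show "inj_on (\<lambda>(x, b). (b, (b + x) mod p)) E"
      proof (rule inj_onI, clarsimp)
        fix x b x' assume *: "(x, b) \<in> E" "(x', b) \<in> E" "(b + x) mod p = (b + x') mod p"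
        then have "x \<in> {0..<p}" "x' \<in> {0..<p}" by (auto simp: E_def X_def)
        moreover have "(x + b) mod p = (x' + b) mod p" using *(3) by (simp only: add.commute)
        ultimately show "x = x'" using inj_onD[OF inj_on_translate_mod[of "{0..<p}" p b]] by blast
      qed
    qed (use finB in \<open>auto simp: E_def\<close>)
    finally have "card (X t) * (card B - t) \<le> card B * card B" by (simp add: card_cartesian_product)
    then have "card (X t) * (4 * (card B - t)) \<le> 4 * card B * card B" by simp
    moreover have "3 * card B \<le> 4 * (card B - t)" using t by simp
    ultimately have "card (X t) * (3 * card B) \<le> 4 * card B * card B"
      using mult_le_mono2[of "3 * card B" "4 * (card B - t)" "card (X t)"] by linarith
    then have "card B * (3 * card (X t)) \<le> card B * (4 * card B)" by (simp add: algebra_simps)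
    then show ?thesis using g by simp
  qed
  \<comment> \<open>The largest \<open>j\<close> for which \<open>upper\<close> still applies to
    \<open>X (j * g)\<close>.\<close>
  define j where "j = card B div (4 * g)"
  have j: "j * (4 * g) \<le> card B" "card B < j * (4 * g) + 4 * g" 
    using g div_mult_mod_eq[of "card B" "4 * g"] mod_less_divisor[of "4 * g" "card B"]
    unfolding j_def by linarith+
  have j1: "j \<ge> 1" using g by (simp add: j_def div_greater_zero_iff Suc_leI)
  have up: "3 * card (X (j * g)) \<le> 4 * card B" using upper[of "j * g"] j by (simp add: algebra_simps)
  \<comment> \<open>The size stays below \<open>p\<close>, so the minimum in \<open>grow\<close> is
    its second argument.\<close>
  have "card (X (j * g)) < nat p" using up half g by linarith
  moreover define m where "m = card (X g) - 1"
  ultimately have "j * m + 1 \<le> card (X (j * g))" using grow[of j] by simp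
  then have "3 * (j * m) < 3 * card (X (j * g))" by linarith
  also have "\<dots> \<le> 4 * card B" by (rule up)
  also have "\<dots> < 4 * (j * (4 * g) + 4 * g)" by (rule mult_strict_left_mono[OF j(2)]) simp
  also have "\<dots> \<le> 32 * (j * g)" using j1 by simp
  finally have "j * (3 * m) < j * (32 * g)" by (simp add: algebra_simps)
  then have "3 * m < 32 * g" by simp
  then have "card (X g) \<le> 12 * g" using g unfolding m_def by linarith
  then show ?thesis by (simp add: X_def)
qed

section \<open>Subset sums\<close>

text \<open>Indexed by positions and not by values, since the generators in (a) may repeat.\<close>

definition subset_sums :: "int \<Rightarrow> ('i \<Rightarrow> int) \<Rightarrow> 'i set \<Rightarrow> int set" where
  "subset_sums n a J = (\<lambda>T. sum a T mod n) ` Pow J"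

lemma subset_sums_subset: "n > 0 \<Longrightarrow> subset_sums n a J \<subseteq> {0..<n}"
  by (auto simp: subset_sums_def)

lemma finite_subset_sums: "n > 0 \<Longrightarrow> finite (subset_sums n a J)"
  using finite_subset[OF subset_sums_subset] by blast

lemma zero_in_subset_sums: "0 \<in> subset_sums n a J"
  unfolding subset_sums_def by (rule image_eqI[of _ _ "{}"]) auto

lemma subset_sums_insert:
  assumes "finite J" "i \<notin> J"
  shows "subset_sums n a (insert i J) =
    subset_sums n a J \<union> translate_mod n (a i) (subset_sums n a J)"
proof -
  have "sum a (insert i T) mod n = (sum a T mod n + a i) mod n" if "T \<in> Pow J" for T
  proof -
    have "finite T" "i \<notin> T" using that assms finite_subset by auto
    then show ?thesis by (simp add: mod_simps add.commute)
  qed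
  then show ?thesis
    unfolding subset_sums_def translate_mod_def Pow_insert image_Un image_image
    by (metis (no_types, lifting) image_cong)
qed

lemma plus_mod_subset_sums:
  assumes "finite J" "finite K" "J \<inter> K = {}"
  shows "plus_mod n (subset_sums n a J) (subset_sums n a K) \<subseteq> subset_sums n a (J \<union> K)"
proof
  fix z assume "z \<in> plus_mod n (subset_sums n a J) (subset_sums n a K)"
  then obtain S T where ST: "S \<subseteq> J" "T \<subseteq> K" "z = (sum a S + sum a T) mod n"
    by (auto simp: plus_mod_def subset_sums_def mod_simps)
  have "sum a (S \<union> T) = sum a S + sum a T"
    by (rule sum.union_disjoint) (use ST assms finite_subset in auto)
  then show "z \<in> subset_sums n a (J \<union> K)"
    using ST unfolding subset_sums_def by (auto intro!: image_eqI[of _ _ "S \<union> T"])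
qed

lemma card_subset_sums_insert:
  assumes "n > 0" "finite J" "i \<notin> J"
  shows "card (subset_sums n a (insert i J)) = card (subset_sums n a J) +
    card (translate_mod n (a i) (subset_sums n a J) - subset_sums n a J)"
proof -
  let ?S = "subset_sums n a J"
  have fin: "finite ?S" by (rule finite_subset_sums[OF assms(1)])
  have "subset_sums n a (insert i J) = ?S \<union> (translate_mod n (a i) ?S - ?S)"
    unfolding subset_sums_insert[OF assms(2,3)] by blast
  then show ?thesis
    using card_Un_disjoint[of ?S "translate_mod n (a i) ?S - ?S"] fin
    by (simp add: translate_mod_def Int_Diff)
qed

text \<open>A nonempty proper set of residues is not closed under adding a unit.\<close>

lemma card_subset_sums_insert_unit:
  fixes p :: int
  assumes "prime p" "finite J" "i \<notin> J" "\<not> p dvd a i" "card (subset_sums p a J) < nat p"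
  shows "card (subset_sums p a J) + 1 \<le> card (subset_sums p a (insert i J))"
proof -
  let ?S = "subset_sums p a J"
  have p0: "p > 0" using assms by (simp add: prime_gt_0_int)
  have "?S \<noteq> {0..<p}" using assms(5) by auto
  then have "translate_mod p (a i) ?S - ?S \<noteq> {}"
    using translate_closed_imp_full[OF assms(1,4) subset_sums_subset[OF p0], of a J]
      zero_in_subset_sums[of p a J]
    by (auto simp: translate_mod_def)
  then have "card (translate_mod p (a i) ?S - ?S) \<noteq> 0"
    using finite_subset_sums[OF p0, of a J] by (simp add: translate_mod_def)
  then show ?thesis using card_subset_sums_insert[OF p0 assms(2,3), of a] by simp
qed

lemma card_subset_sums_units:
  fixes p :: int
  assumes p: "prime p" and "finite J" "\<And>i. i \<in> J \<Longrightarrow> \<not> p dvd a i"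
  shows "min (nat p) (card J + 1) \<le> card (subset_sums p a J)"
  using assms(2,3)
proof (induction J)
  case empty
  have "card (subset_sums p a {}) \<noteq> 0"
    using zero_in_subset_sums finite_subset_sums prime_gt_0_int[OF p] by (metis card_0_eq empty_iff)
  then show ?case by simp
next
  case (insert i J)
  have "card (subset_sums p a J) \<le> card (subset_sums p a (insert i J))"
    using card_subset_sums_insert[OF prime_gt_0_int[OF p] insert.hyps] by simp
  then show ?case
    using insert card_subset_sums_insert_unit[OF p insert.hyps(1,2), of a]
    by (cases "card (subset_sums p a J) < nat p") auto
qed

lemma subset_sums_full:
  fixes p :: int
  assumes "p > 0" "nat p \<le> card (subset_sums p a J)"
  shows "subset_sums p a J = {0..<p}"
  by (rule card_seteq) (use assms subset_sums_subset in auto)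

text \<open>Below size \<open>4 * g\<close> every unit enlarges the set of subset sums; above it, one of more than
  \<open>12 * g\<close> available residues adds at least \<open>g\<close> new sums.\<close>
lemma obtain_many_subset_sums:
  fixes p :: int and a :: "'i \<Rightarrow> int"
  assumes p: "prime p" and I: "finite I" "\<And>i. i \<in> I \<Longrightarrow> \<not> p dvd a i" and g: "1 \<le> g"
    and spread: "\<And>I'. I' \<subseteq> I \<Longrightarrow> card I \<le> card I' + s \<Longrightarrow> 12 * g < card ((\<lambda>i. a i mod p) ` I')"
    and s: "nat p < 8 * g + 2 * (g * (s - 4 * g))" "4 * g \<le> s"
  obtains J where "J \<subseteq> I" "card J \<le> s" "nat p < 2 * card (subset_sums p a J)"
proof -
  have p0: "p > 0" using p by (simp add: prime_gt_0_int)
  \<comment> \<open>The first \<open>4 * g\<close> choices are credited with one new sum each and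
    every later one with \<open>g\<close>, unless more than half of the residues have been
    reached.\<close>
  have "\<exists>J\<subseteq>I. card J \<le> n \<and> (nat p < 2 * card (subset_sums p a J) \<or>
      min n (4 * g) + g * (n - 4 * g) \<le> card (subset_sums p a J))" if "n \<le> s" for n
    using that
  proof (induction n)
    case 0
    show ?case by (rule exI[of _ "{}"]) simp
  next
    case (Suc n)
    then obtain J where J: "J \<subseteq> I" "card J \<le> n" "nat p < 2 * card (subset_sums p a J) \<or>
      min n (4 * g) + g * (n - 4 * g) \<le> card (subset_sums p a J)" by auto
    let ?S = "subset_sums p a J"
    have finJ: "finite J" using J I finite_subset by blast
    show ?case
    proof (cases "nat p < 2 * card ?S")
      case True
      then show ?thesis using J by (intro exI[of _ J]) auto
    next
      case False
      with J have size: "min n (4 * g) + g * (n - 4 * g) \<le> card ?S" by blast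
      have "card I \<le> card (I - J) + s"
        using card_Diff_subset[OF finJ J(1)] J(2) Suc.prems by linarith
      then have many: "12 * g < card ((\<lambda>i. a i mod p) ` (I - J))" by (intro spread) auto
      have pos: "card ?S < nat p" using False p0 by linarith
      have "\<exists>i\<in>I - J. min (Suc n) (4 * g) + g * (Suc n - 4 * g) \<le> card (subset_sums p a (insert i J))"
      proof (cases "4 * g \<le> card ?S")
        case small: False
        from many have "I - J \<noteq> {}" by (metis card.empty image_empty not_less_zero)
        then obtain i where i: "i \<in> I - J" by blast
        have "card ?S + 1 \<le> card (subset_sums p a (insert i J))"
          by (rule card_subset_sums_insert_unit[OF p finJ]) (use i I pos in auto)
        moreover have "n < 4 * g" using small size by (auto simp: min_def split: if_splits)
        ultimately show ?thesis using i size by (intro bexI[of _ i]) auto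
      next
        case True
        have "card {x \<in> {0..<p}. card (translate_mod p x ?S - ?S) \<le> g} \<le> 12 * g"
          by (rule card_small_growth[OF p subset_sums_subset[OF p0] g True]) (use False in simp)
        with many have "\<not> (\<lambda>i. a i mod p) ` (I - J) \<subseteq> {x \<in> {0..<p}. card (translate_mod p x ?S - ?S) \<le> g}"
          using card_mono[of "{x \<in> {0..<p}. card (translate_mod p x ?S - ?S) \<le> g}"
            "(\<lambda>i. a i mod p) ` (I - J)"] by fastforce
        then obtain i where i: "i \<in> I - J" "\<not> card (translate_mod p (a i mod p) ?S - ?S) \<le> g"
          using p0 by auto
        have "translate_mod p (a i mod p) ?S = translate_mod p (a i) ?S"
          by (simp add: translate_mod_def mod_simps)
        then have "card ?S + g < card (subset_sums p a (insert i J))"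
          using i card_subset_sums_insert[OF p0 finJ, of i a] by auto
        \<comment> \<open>For \<open>n < 4 * g\<close> the left side is at most
          \<open>4 * g\<close>, which \<open>card ?S\<close> has already reached.\<close>
        moreover have "min (Suc n) (4 * g) + g * (Suc n - 4 * g) \<le> card ?S + g"
          using size True g by (cases "n < 4 * g") (auto simp: Suc_diff_le)
        ultimately show ?thesis using i by (intro bexI[of _ i]) auto
      qed
      then obtain i where i: "i \<in> I - J"
        "min (Suc n) (4 * g) + g * (Suc n - 4 * g) \<le> card (subset_sums p a (insert i J))" by blast
      then show ?thesis using J finJ by (intro exI[of _ "insert i J"]) (auto simp: card_insert_if)
    qed
  qed
  from this[of s] obtain J where J: "J \<subseteq> I" "card J \<le> s" "nat p < 2 * card (subset_sums p a J) \<or>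
      min s (4 * g) + g * (s - 4 * g) \<le> card (subset_sums p a J)" by auto
  moreover have "nat p < 2 * card (subset_sums p a J)" using J(3) s by auto
  ultimately show thesis using that by blast
qed

section \<open>Disjoint families with all residues as subset sums\<close>

lemma plus_mod_full:
  fixes n :: int
  assumes n: "n > 0" and A: "A \<subseteq> {0..<n}" and B: "B \<subseteq> {0..<n}" and "nat n < card A + card B"
  shows "plus_mod n A B = {0..<n}"
proof (rule antisym[OF plus_mod_subset[OF n]], rule subsetI)
  fix z assume z: "z \<in> {0..<n}"
  define B' where "B' = (\<lambda>y. (z - y) mod n) ` B"
  have "inj_on (\<lambda>y. (z - y) mod n) B"
  proof (rule inj_onI)
    fix x y assume xy: "x \<in> B" "y \<in> B" "(z - x) mod n = (z - y) mod n"
    then have "x mod n = y mod n"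
      using mod_diff_cong[of z n z "z - x" "z - y"] by simp
    moreover have "x mod n = x" "y mod n = y" using B xy by auto
    ultimately show "x = y" by simp
  qed
  then have card_B': "card B' = card B" unfolding B'_def by (rule card_image)
  have B': "B' \<subseteq> {0..<n}" using n by (auto simp: B'_def)
  \<comment> \<open>Pigeonhole: \<open>A\<close> and the reflected set \<open>z - B\<close> together
    have more than \<open>n\<close> elements.\<close>
  have "A \<inter> B' \<noteq> {}"
  proof
    assume "A \<inter> B' = {}"
    then have "card A + card B' = card (A \<union> B')"
      using A B' by (subst card_Un_disjoint) (auto intro: finite_subset)
    also have "\<dots> \<le> card {0..<n}" by (rule card_mono) (use A B' in auto)
    finally show False using assms card_B' by simp
  qed
  then obtain y where y: "y \<in> B" "(z - y) mod n \<in> A" by (auto simp: B'_def)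
  have "((z - y) mod n + y) mod n = z" using z by (simp add: mod_simps)
  with plus_modI[OF y(2,1), of n] show "z \<in> plus_mod n A B" by simp
qed

text \<open>The sums over \<open>R\<close> make any two sums over \<open>T\<close> that agree modulo \<open>p\<close> agree modulo \<open>p\<^sup>2\<close>. So the
  sums over \<open>T\<close> are closed modulo \<open>p\<^sup>2\<close> under adding \<open>a e\<close>, and reach \<open>p * a e\<close>, which agrees
  with the empty sum modulo \<open>p\<close> but not modulo \<open>p\<^sup>2\<close>.\<close>
lemma no_two_full_subset_sums:
  fixes p b :: int and a :: "'i \<Rightarrow> int"
  assumes p: "prime p" and I: "finite I"
    and cube: "\<And>J. J \<subseteq> I \<Longrightarrow> p dvd b + sum a J \<Longrightarrow> p\<^sup>2 dvd b + sum a J"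
    and R: "R \<subseteq> I" "subset_sums p a R = {0..<p}"
    and T: "T \<subseteq> I" "subset_sums p a T = {0..<p}"
    and e: "e \<in> I" "e \<notin> R" "e \<notin> T" "\<not> p dvd a e" and RT: "R \<inter> T = {}"
  shows False
proof -
  have p0: "p > 0" using p by (simp add: prime_gt_0_int)
  have hit: "\<exists>K\<subseteq>J. p dvd x + sum a K" if "subset_sums p a J = {0..<p}" for J x
  proof -
    have "(- x) mod p \<in> subset_sums p a J" using that p0 by simp
    then obtain K where "K \<subseteq> J" "(- x) mod p = sum a K mod p" by (auto simp: subset_sums_def)
    then have "K \<subseteq> J" "p dvd - (x + sum a K)" by (simp_all add: mod_eq_dvd_iff)
    then show ?thesis by (metis dvd_minus_iff)
  qed
  have lift: "p\<^sup>2 dvd sum a S - sum a S'"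
    if S: "S \<subseteq> insert e T" "S' \<subseteq> insert e T" "p dvd sum a S - sum a S'" for S S'
  proof -
    \<comment> \<open>The same \<open>K\<close> completes both \<open>S\<close> and
      \<open>S'\<close> to multiples of \<open>p\<close>, so \<open>cube\<close> applies to both and
      \<open>K\<close> cancels in the difference.\<close>
    obtain K where K: "K \<subseteq> R" "p dvd (b + sum a S) + sum a K" using hit[OF R(2)] by blast
    have fin: "finite K" "finite S" "finite S'"
      using K R S T I e by (meson finite_subset finite_insert)+
    have disj: "S \<inter> K = {}" "S' \<inter> K = {}" using S K RT e by blast+
    have u: "sum a (S \<union> K) = sum a S + sum a K" "sum a (S' \<union> K) = sum a S' + sum a K"
      using fin disj by (simp_all add: sum.union_disjoint)
    have "S \<union> K \<subseteq> I" "S' \<union> K \<subseteq> I" using S K R T e by blast+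
    moreover have "p dvd b + sum a (S \<union> K)" using K u by (simp add: algebra_simps)
    moreover have "p dvd b + sum a (S' \<union> K)"
      using dvd_diff[OF K(2) S(3)] u by (simp add: algebra_simps)
    ultimately have "p\<^sup>2 dvd (b + sum a (S \<union> K)) - (b + sum a (S' \<union> K))"
      using cube by (intro dvd_diff) auto
    then show ?thesis using u by simp
  qed
  have "\<exists>S\<subseteq>T. p\<^sup>2 dvd sum a S - int k * a e" for k
  proof (induction k)
    case 0
    show ?case by (rule exI[of _ "{}"]) simp
  next
    case (Suc k)
    then obtain S where S: "S \<subseteq> T" "p\<^sup>2 dvd sum a S - int k * a e" by blast
    have "e \<notin> S" using S e by blast
    moreover have "finite S" using S T I by (meson finite_subset)
    ultimately have ins: "sum a (insert e S) = a e + sum a S" by simp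
    \<comment> \<open>Fullness of \<open>T\<close> replaces \<open>insert e S\<close> by a subset of
      \<open>T\<close> congruent to it modulo \<open>p\<close>; \<open>lift\<close> upgrades this to
      modulo \<open>p\<^sup>2\<close>, and \<open>e\<close> is free again.\<close>
    obtain S' where S': "S' \<subseteq> T" "p dvd - (a e + sum a S) + sum a S'" using hit[OF T(2)] by blast
    have "p\<^sup>2 dvd sum a S' - sum a (insert e S)"
      by (rule lift) (use S S' ins in \<open>auto simp: algebra_simps\<close>)
    from dvd_add[OF this S(2)] have "p\<^sup>2 dvd sum a S' - int (Suc k) * a e"
      by (simp add: ins algebra_simps)
    then show ?case using S' by blast
  qed
  from this[of "nat p"] obtain S where S: "S \<subseteq> T" "p\<^sup>2 dvd sum a S - p * a e" using p0 by auto
  have "p dvd p\<^sup>2" by simp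
  then have "p dvd (sum a S - p * a e) + p * a e" using S(2) by (meson dvd_add dvd_trans dvd_triv_left)
  then have "p\<^sup>2 dvd sum a S" using lift[of S "{}"] S by auto
  from dvd_diff[OF this S(2)] have "p * p dvd p * a e" by (simp add: power2_eq_square)
  then show False using e p0 by simp
qed

text \<open>Among more than \<open>2 * p\<close> units there are two disjoint sets of
  \<open>p\<close> units, each with all residues as subset sums, and one unit to spare.\<close>

lemma card_units_le:
  fixes p b :: int and a :: "'i \<Rightarrow> int"
  assumes p: "prime p" and I: "finite I"
    and cube: "\<And>J. J \<subseteq> I \<Longrightarrow> p dvd b + sum a J \<Longrightarrow> p\<^sup>2 dvd b + sum a J"
  shows "card {i \<in> I. \<not> p dvd a i} \<le> 2 * nat p"
proof (rule ccontr)
  let ?U = "{i \<in> I. \<not> p dvd a i}"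
  assume "\<not> ?thesis"
  then have big: "2 * nat p < card ?U" by simp
  have p0: "p > 0" using p by (simp add: prime_gt_0_int)
  have full: "subset_sums p a J = {0..<p}" if "J \<subseteq> ?U" "card J = nat p" for J
    using card_subset_sums_units[OF p, of J a] that I finite_subset
    by (intro subset_sums_full[OF p0]) fastforce
  obtain R where R: "R \<subseteq> ?U" "card R = nat p"
    using obtain_subset_with_card_n[of "nat p" ?U] big by auto
  have finR: "finite R" using R I finite_subset by fastforce
  have "nat p < card (?U - R)" using card_Diff_subset[OF finR R(1)] R big by simp
  then obtain T where T: "T \<subseteq> ?U - R" "card T = nat p"
    using obtain_subset_with_card_n[of "nat p" "?U - R"] by auto
  have "T \<noteq> ?U - R" using T \<open>nat p < card (?U - R)\<close> by auto
  then obtain e where "e \<in> ?U - R" "e \<notin> T" using T by blast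
  then show False
    using R T by (intro no_two_full_subset_sums[OF p I cube, of R T e] full) auto
qed

text \<open>Otherwise the greedy choice succeeds four times on disjoint sets of at most
  \<open>s\<close> units, each reaching more than half of the residues. Joined in pairs they give
  two full families, and \<open>4 * s < card U\<close> leaves a spare unit.\<close>

lemma units_concentrate:
  fixes p b :: int and a :: "'i \<Rightarrow> int"
  assumes p: "prime p" and I: "finite I"
    and cube: "\<And>J. J \<subseteq> I \<Longrightarrow> p dvd b + sum a J \<Longrightarrow> p\<^sup>2 dvd b + sum a J"
    and units: "U \<subseteq> I" "\<And>i. i \<in> U \<Longrightarrow> \<not> p dvd a i" and g: "1 \<le> g"
    and s: "nat p < 8 * g + 2 * (g * (s - 4 * g))" "4 * g \<le> s" "4 * s < card U"
  obtains I' where "I' \<subseteq> U" "card U \<le> card I' + 4 * s" "card ((\<lambda>i. a i mod p) ` I') \<le> 12 * g"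
proof (rule ccontr)
  assume "\<not> thesis"
  with that have spread: "12 * g < card ((\<lambda>i. a i mod p) ` I')"
    if "I' \<subseteq> U" "card U \<le> card I' + 4 * s" for I' using that by (meson not_le)
  have p0: "p > 0" using p by (simp add: prime_gt_0_int)
  have finU: "finite U" using units I finite_subset by blast
  \<comment> \<open>\<open>V\<close> holds the units already used; dropping \<open>s\<close> more
    from \<open>U - V\<close> stays within the \<open>4 * s\<close> that \<open>spread\<close>
    permits.\<close>
  have step: "\<exists>J\<subseteq>U - V. card J \<le> s \<and> nat p < 2 * card (subset_sums p a J)"
    if V: "V \<subseteq> U" "card V \<le> 3 * s" for V
  proof -
    have finV: "finite V" using V finU finite_subset by blast
    have cd: "card (U - V) = card U - card V" by (rule card_Diff_subset[OF finV V(1)])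
    obtain J where "J \<subseteq> U - V" "card J \<le> s" "nat p < 2 * card (subset_sums p a J)"
    proof (rule obtain_many_subset_sums[OF p _ _ g _ s(1,2), of "U - V" a])
      show "12 * g < card ((\<lambda>i. a i mod p) ` I')" if "I' \<subseteq> U - V" "card (U - V) \<le> card I' + s" for I'
        using that V cd by (intro spread) auto
    qed (use finU units in auto)
    then show ?thesis by blast
  qed
  have fullU: "subset_sums p a (J \<union> K) = {0..<p}"
    if "finite J" "finite K" "J \<inter> K = {}" "nat p < 2 * card (subset_sums p a J)"
      "nat p < 2 * card (subset_sums p a K)" for J K
  proof -
    have "plus_mod p (subset_sums p a J) (subset_sums p a K) = {0..<p}"
      by (rule plus_mod_full[OF p0]) (use subset_sums_subset[OF p0] that in auto)
    then show ?thesis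
      using plus_mod_subset_sums[OF that(1-3), of p a] subset_sums_subset[OF p0, of a "J \<union> K"] by simp
  qed
  obtain J1 where J1: "J1 \<subseteq> U" "card J1 \<le> s" "nat p < 2 * card (subset_sums p a J1)"
    using step[of "{}"] by auto
  obtain J2 where J2: "J2 \<subseteq> U - J1" "card J2 \<le> s" "nat p < 2 * card (subset_sums p a J2)"
    using step[of J1] J1 by auto
  have c2: "card (J1 \<union> J2) \<le> 2 * s" using card_Un_le[of J1 J2] J1 J2 by linarith
  obtain J3 where J3: "J3 \<subseteq> U - (J1 \<union> J2)" "card J3 \<le> s" "nat p < 2 * card (subset_sums p a J3)"
    using step[of "J1 \<union> J2"] J1 J2 c2 by auto
  have c3: "card (J1 \<union> J2 \<union> J3) \<le> 3 * s" using card_Un_le[of "J1 \<union> J2" J3] c2 J3 by linarith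
  obtain J4 where J4: "J4 \<subseteq> U - (J1 \<union> J2 \<union> J3)" "card J4 \<le> s" "nat p < 2 * card (subset_sums p a J4)"
    using step[of "J1 \<union> J2 \<union> J3"] J1 J2 J3 c3 by auto
  have "card (J1 \<union> J2 \<union> J3 \<union> J4) < card U"
    using card_Un_le[of "J1 \<union> J2 \<union> J3" J4] c3 J4 s by linarith
  then have "\<not> U \<subseteq> J1 \<union> J2 \<union> J3 \<union> J4"
    using card_mono[of "J1 \<union> J2 \<union> J3 \<union> J4" U] finU J1 J2 J3 J4
    by (metis (no_types, lifting) Diff_subset finite_UnI finite_subset leD order_trans)
  then obtain e where e: "e \<in> U" "e \<notin> J1 \<union> J2" "e \<notin> J3 \<union> J4" by blast
  have fins: "finite J1" "finite J2" "finite J3" "finite J4"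
    using J1 J2 J3 J4 finU by (meson Diff_subset finite_subset order_trans)+
  show False
  proof (rule no_two_full_subset_sums[OF p I cube, of "J1 \<union> J2" "J3 \<union> J4" e])
    show "subset_sums p a (J1 \<union> J2) = {0..<p}"
      by (rule fullU) (use fins J1 J2 in auto)
    show "subset_sums p a (J3 \<union> J4) = {0..<p}"
      by (rule fullU) (use fins J3 J4 in auto)
  qed (use e units J1(1) J2(1) J3(1) J4(1) in auto)
qed

section \<open>Counting by prime divisors\<close>

text \<open>Cauchy--Schwarz for the sizes of the fibres of \<open>f\<close>.\<close>

lemma card_sq_le_card_image_mult_pairs:
  assumes "finite S"
  shows "(card S)\<^sup>2 \<le> card (f ` S) * card {(i, j) \<in> S \<times> S. f i = f j}"
proof -
  define n where "n = (\<lambda>r. card {i \<in> S. f i = r})"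
  have "{(i, j) \<in> S \<times> S. f i = f j} =
      (\<Union>r\<in>f ` S. {i \<in> S. f i = r} \<times> {i \<in> S. f i = r})" by auto
  moreover have "card (\<Union>r\<in>f ` S. {i \<in> S. f i = r} \<times> {i \<in> S. f i = r}) = (\<Sum>r\<in>f ` S. (n r)\<^sup>2)"
    using assms
    by (subst card_UN_disjoint) (auto simp: n_def card_cartesian_product power2_eq_square)
  ultimately have pairs: "card {(i, j) \<in> S \<times> S. f i = f j} = (\<Sum>r\<in>f ` S. (n r)\<^sup>2)" by simp
  have "card S = (\<Sum>r\<in>f ` S. n r)"
    using sum.image_gen[OF assms, of "\<lambda>_. 1::nat" f] by (simp add: n_def)
  moreover have "(\<Sum>r\<in>f ` S. real (n r))\<^sup>2 \<le> (\<Sum>r\<in>f ` S. (real (n r))\<^sup>2) * card (f ` S)"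
    by (rule sum_squared_le_sum_of_squares)
  ultimately have "real ((card S)\<^sup>2) \<le> real (card (f ` S) * card {(i, j) \<in> S \<times> S. f i = f j})"
    unfolding pairs by (simp add: mult.commute)
  then show ?thesis by (simp only: of_nat_le_iff)
qed

lemma prod_primes_dvd:
  fixes n :: nat
  assumes "finite Q" "\<And>p. p \<in> Q \<Longrightarrow> prime p" "\<And>p. p \<in> Q \<Longrightarrow> p dvd n"
  shows "\<Prod>Q dvd n"
  using assms
proof (induction Q)
  case (insert q Q)
  have "coprime q (\<Prod>Q)"
    by (rule prod_coprime_right) (use insert in \<open>auto intro!: primes_coprime\<close>)
  then show ?case using insert by (auto intro!: divides_mult)
qed simp

lemma sum_ln_prime_divisors_le:
  fixes n :: nat
  assumes "finite Q" "\<And>p. p \<in> Q \<Longrightarrow> prime p" "n > 0"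
  shows "(\<Sum>p\<in>{p \<in> Q. p dvd n}. ln (real p)) \<le> ln (real n)"
proof -
  let ?Q = "{p \<in> Q. p dvd n}"
  have nz: "real p \<noteq> 0" if "p \<in> ?Q" for p using assms that not_prime_0 by auto
  have "(\<Sum>p\<in>?Q. ln (real p)) = ln (\<Prod>p\<in>?Q. real p)"
    by (rule ln_prod[symmetric]) (use assms nz in auto)
  also have "(\<Prod>p\<in>?Q. real p) = real (\<Prod>?Q)" by simp
  also have "ln (real (\<Prod>?Q)) \<le> ln (real n)"
  proof (rule ln_mono)
    have "\<Prod>?Q dvd n" using assms by (intro prod_primes_dvd) auto
    then have "\<Prod>?Q \<le> n" using assms by (intro dvd_imp_le)
    then show "real (\<Prod>?Q) \<le> real n" by (simp only: of_nat_le_iff)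
    show "0 < real (\<Prod>?Q)" using nz by (auto intro!: prod_pos)
  qed
  finally show ?thesis .
qed

text \<open>Double counting: the primes dividing one value \<open>h x\<close> have total logarithm
  at most \<open>ln N\<close>. For (a) the values are the generators, for (b) the differences of
  pairs.\<close>

lemma sum_ln_mult_card_dvd_le:
  fixes h :: "'b \<Rightarrow> nat"
  assumes Q: "finite Q" "\<And>p. p \<in> Q \<Longrightarrow> prime p" and Y: "finite Y" "\<And>x. x \<in> Y \<Longrightarrow> h x \<in> {1..N}"
  shows "(\<Sum>p\<in>Q. ln (real p) * real (card {x \<in> Y. p dvd h x})) \<le> real (card Y) * ln (real N)"
proof -
  have "(\<Sum>p\<in>Q. ln (real p) * real (card {x \<in> Y. p dvd h x})) =
      (\<Sum>p\<in>Q. \<Sum>x\<in>Y. if p dvd h x then ln (real p) else 0)"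
    using Y by (intro sum.cong) (auto simp: sum.If_cases Int_def mult.commute)
  also have "\<dots> = (\<Sum>x\<in>Y. \<Sum>p\<in>Q. if p dvd h x then ln (real p) else 0)"
    by (rule sum.swap)
  also have "\<dots> = (\<Sum>x\<in>Y. \<Sum>p\<in>{p \<in> Q. p dvd h x}. ln (real p))"
    using Q by (simp add: sum.If_cases Int_def)
  also have "\<dots> \<le> (\<Sum>x\<in>Y. ln (real N))"
  proof (rule sum_mono)
    fix x assume "x \<in> Y"
    then have hx: "1 \<le> h x" "h x \<le> N" using Y by auto
    have "(\<Sum>p\<in>{p \<in> Q. p dvd h x}. ln (real p)) \<le> ln (real (h x))"
      by (rule sum_ln_prime_divisors_le) (use Q hx in auto)
    also have "\<dots> \<le> ln (real N)" using hx by (intro ln_mono) auto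
    finally show "(\<Sum>p\<in>{p \<in> Q. p dvd h x}. ln (real p)) \<le> ln (real N)" .
  qed
  finally show ?thesis by simp
qed

text \<open>Carries the condition of \<open>W_set\<close> over to integers, where the residue
  arguments take place.\<close>

lemma W_set_int_square_dvd:
  assumes "b + sum a J \<in> W_set P" "p \<in> P" "int p dvd int b + (\<Sum>i\<in>J. int (a i))"
  shows "(int p)\<^sup>2 dvd int b + (\<Sum>i\<in>J. int (a i))"
proof -
  have e: "int b + (\<Sum>i\<in>J. int (a i)) = int (b + sum a J)" by simp
  have "p dvd b + sum a J" using assms(3) unfolding e by (simp only: int_dvd_int_iff)
  then have "p\<^sup>2 dvd b + sum a J" using assms by (simp add: W_set_def)
  then show ?thesis unfolding e by (simp only: int_dvd_int_iff flip: of_nat_power)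
qed

text \<open>If at least half of the generators are divisible by \<open>p\<close>, these are all
  congruent. Otherwise \<open>m\<close> units, most of them in about \<open>p / m\<close> classes,
  yield of the order of \<open>m ^ 3 / p\<close> pairs by Cauchy--Schwarz.\<close>

lemma many_congruent_pairs:
  fixes a :: "'i \<Rightarrow> nat" and p b :: nat
  assumes p: "prime p" "p \<in> P" and I: "finite I"
    and cube: "\<And>J. J \<subseteq> I \<Longrightarrow> b + sum a J \<in> W_set P"
    and D: "card I \<le> 4 * p" "13824 * p \<le> (card I)\<^sup>2"
  shows "(card I) ^ 3 \<le> 13824 * p * card {(i, j) \<in> I \<times> I. i \<noteq> j \<and> a i mod p = a j mod p}"
proof -
  let ?D = "card I" and ?a = "\<lambda>i. int (a i)"
  \<comment> \<open>Cauchy--Schwarz counts the diagonal as well; it is removed at the end.\<close>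
  define Eq where "Eq = {(i, j) \<in> I \<times> I. a i mod p = a j mod p}"
  define Off where "Off = {(i, j) \<in> I \<times> I. i \<noteq> j \<and> a i mod p = a j mod p}"
  define U where "U = {i \<in> I. \<not> int p dvd ?a i}"
  define m where "m = card U"
  have pi: "prime (int p)" using p by simp
  have p1: "p \<ge> 2" using p by (simp add: prime_ge_2_nat)
  have cube': "(int p)\<^sup>2 dvd int b + sum ?a J" if "J \<subseteq> I" "int p dvd int b + sum ?a J" for J
    using W_set_int_square_dvd[OF cube[OF that(1)] p(2)] that by simp
  have finEq: "finite Eq" by (rule finite_subset[of _ "I \<times> I"]) (use I in \<open>auto simp: Eq_def\<close>)
  have "Eq = Off \<union> (\<lambda>i. (i, i)) ` I" "Off \<inter> (\<lambda>i. (i, i)) ` I = {}"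
    by (auto simp: Eq_def Off_def)
  then have card_Eq: "card Eq = card Off + ?D"
    using finEq I by (simp add: card_Un_disjoint card_image inj_on_def)
  have UI: "U \<subseteq> I" and finU: "finite U" using I by (auto simp: U_def)
  have mD: "m \<le> ?D" unfolding m_def by (rule card_mono[OF I UI])
  have main: "?D ^ 3 \<le> 6912 * (p * card Eq)"
  proof (cases "2 * m \<le> ?D")
    case True
    have "(I - U) \<times> (I - U) \<subseteq> Eq" by (auto simp: U_def Eq_def)
    then have "card ((I - U) \<times> (I - U)) \<le> card Eq" by (rule card_mono[OF finEq])
    then have "(?D - m) * (?D - m) \<le> card Eq"
      using card_Diff_subset[OF finU UI] by (simp add: card_cartesian_product m_def)
    moreover have "(?D) * ?D \<le> (2 * (?D - m)) * (2 * (?D - m))"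
      by (rule mult_mono) (use True in auto)
    ultimately have "?D * ?D \<le> 4 * card Eq" by simp
    then have "?D * (?D * ?D) \<le> (4 * p) * (4 * card Eq)" by (rule mult_le_mono[OF D(1)])
    then show ?thesis by (simp add: power3_eq_cube)
  next
    case False
    then have m2: "?D \<le> 2 * m" and m0: "m > 0" by auto
    have mp: "m \<le> 2 * p" using card_units_le[OF pi I cube'] by (simp add: m_def U_def)
    have "?D * ?D \<le> (2 * m) * (2 * m)" by (rule mult_mono) (use m2 in auto)
    then have mm: "3456 * p \<le> m * m" using D(2) by (simp add: power2_eq_square)
    have m16: "m \<ge> 32"
    proof (rule ccontr)
      assume "\<not> ?thesis"
      then have "m * m \<le> 32 * 32" by (intro mult_mono) auto
      then show False using mm p1 by simp
    qed
    \<comment> \<open>With \<open>g\<close> just above \<open>16 * p / m\<close> and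
      \<open>s\<close> about \<open>m / 8\<close>, the product \<open>g * s\<close> exceeds
      \<open>p\<close>, as \<open>units_concentrate\<close> demands, while dropping
      \<open>4 * s\<close> units keeps at least half of \<open>U\<close>.\<close>
    define g where "g = 16 * p div m + 1"
    define s where "s = m div 8"
    have g_lo: "16 * p < g * m"
      using dividend_less_div_times[OF m0, of "16 * p"] by (simp add: g_def algebra_simps)
    \<comment> \<open>The added 1 costs \<open>m\<close>, which is at most
      \<open>2 * p\<close>.\<close>
    have g_hi: "g * m \<le> 18 * p"
      using div_times_less_eq_dividend[of "16 * p" m] mp unfolding g_def distrib_right by linarith
    have s_lo: "m \<le> 12 * s" and s_hi: "8 * s \<le> m" using m16 unfolding s_def by linarith+
    have gs: "8 * g \<le> s"
    proof -
      have "(8 * g) * m \<le> 144 * p" using g_hi by simp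
      also have "12 * \<dots> \<le> m * m" using mm by simp
      finally have "12 * ((8 * g) * m) \<le> m * m" by simp
      also have "\<dots> \<le> (12 * s) * m" using s_lo by simp
      finally show ?thesis using m0 by simp
    qed
    have "g * m \<le> g * (12 * s)" by (rule mult_le_mono2[OF s_lo])
    also have "\<dots> = 12 * (g * s)" by simp
    finally have p_gs: "16 * p < 12 * (g * s)" using g_lo by linarith
    have "g * s \<le> g * (2 * (s - 4 * g))" by (rule mult_le_mono2) (use gs in linarith)
    also have "\<dots> = 2 * (g * (s - 4 * g))" by simp
    finally have s1: "nat (int p) < 8 * g + 2 * (g * (s - 4 * g))"
      using p_gs unfolding nat_int by linarith
    obtain I' where I': "I' \<subseteq> U" "card U \<le> card I' + 4 * s"
      "card ((\<lambda>i. ?a i mod int p) ` I') \<le> 12 * g"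
    proof (rule units_concentrate[OF pi I cube' UI _ _ s1])
      show "4 * s < card U" using s_hi m0 by (simp flip: m_def)
    qed (use gs in \<open>auto simp: U_def g_def\<close>)
    have finI': "finite I'" using I' finU finite_subset by blast
    have "m \<le> 2 * card I'" using I'(2) s_hi unfolding m_def by linarith
    then have "m * m \<le> (2 * card I') * (2 * card I')" by (intro mult_mono) auto
    also have "\<dots> = 4 * (card I')\<^sup>2" by (simp add: power2_eq_square)
    also have "\<dots> \<le> 4 * (card ((\<lambda>i. ?a i mod int p) ` I') *
        card {(i, j) \<in> I' \<times> I'. ?a i mod int p = ?a j mod int p})"
      using card_sq_le_card_image_mult_pairs[OF finI'] by simp
    also have "\<dots> \<le> 4 * ((12 * g) * card Eq)"
    proof -
      have "{(i, j) \<in> I' \<times> I'. ?a i mod int p = ?a j mod int p} \<subseteq> Eq"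
        using I'(1) UI by (auto simp: Eq_def simp flip: zmod_int)
      then show ?thesis using I'(3) by (intro mult_mono card_mono finEq) auto
    qed
    finally have "m * m * m \<le> 48 * g * card Eq * m" by simp
    also have "\<dots> = 48 * card Eq * (g * m)" by simp
    also have "\<dots> \<le> 48 * card Eq * (18 * p)" by (rule mult_le_mono2[OF g_hi])
    finally have m3: "m * m * m \<le> 864 * (p * card Eq)" by (simp add: algebra_simps)
    have "?D * ?D * ?D \<le> (2 * m) * (2 * m) * (2 * m)" by (intro mult_mono) (use m2 in auto)
    then show ?thesis using m3 by (simp add: power3_eq_cube)
  qed
  \<comment> \<open>The diagonal accounts for at most half of \<open>?D ^ 3\<close>; absorbing it
    doubles the constant 6912.\<close>
  have "?D * (13824 * p) \<le> ?D * ?D\<^sup>2" by (rule mult_le_mono2[OF D(2)])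
  then have "13824 * (p * ?D) \<le> ?D ^ 3" by (simp add: power3_eq_cube power2_eq_square algebra_simps)
  with main have "?D ^ 3 \<le> 13824 * (p * card Off)" by (simp add: card_Eq algebra_simps)
  then show ?thesis by (simp add: Off_def mult.assoc)
qed

section \<open>Harmonic and logarithmic sums\<close>

lemma sum_inverse_le_ln:
  assumes "n \<ge> 1"
  shows "(\<Sum>k=1..n. 1 / real k) \<le> 1 + ln (real n)"
  using assms
proof (induction n rule: dec_induct)
  case (step n)
  have "ln (real n / real (Suc n)) \<le> real n / real (Suc n) - 1"
    by (rule ln_le_minus_one) (use step in auto)
  also have "\<dots> = - (1 / real (Suc n))" by (simp add: field_simps)
  finally have "ln (real n) - ln (real (Suc n)) \<le> - (1 / real (Suc n))"
    using step by (simp add: ln_div)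
  then show ?case using step by simp
qed simp

text \<open>Crude: \<open>ln p\<close> is replaced by \<open>ln x\<close>, and the sum of
  \<open>1 / p\<close> is extended to all integers up to \<open>x\<close>. The square of the
  logarithm is later absorbed by a power of \<open>ln N\<close>.\<close>

lemma sum_ln_over_le:
  fixes Q :: "nat set"
  assumes "x \<ge> 1" "\<And>p. p \<in> Q \<Longrightarrow> p \<ge> 1 \<and> real p \<le> x"
  shows "(\<Sum>p\<in>Q. ln (real p) / real p) \<le> ln x * (1 + ln x)"
proof -
  define n where "n = nat \<lfloor>x\<rfloor>"
  have n: "n \<ge> 1" "real n \<le> x" using assms(1) unfolding n_def by linarith+
  have Q: "Q \<subseteq> {1..n}" using assms(2) by (auto simp: n_def le_nat_floor)
  have "(\<Sum>p\<in>Q. ln (real p) / real p) \<le> (\<Sum>p\<in>Q. ln x * (1 / real p))"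
  proof (rule sum_mono)
    fix p assume "p \<in> Q"
    then have "p \<ge> 1" "real p \<le> x" using assms by auto
    then show "ln (real p) / real p \<le> ln x * (1 / real p)" by (simp add: divide_right_mono)
  qed
  also have "\<dots> = ln x * (\<Sum>p\<in>Q. 1 / real p)" by (simp add: sum_distrib_left)
  also have "\<dots> \<le> ln x * (\<Sum>p=1..n. 1 / real p)"
    by (intro mult_left_mono sum_mono2 Q) (use assms in auto)
  also have "\<dots> \<le> ln x * (1 + ln x)"
  proof (rule mult_left_mono)
    have "ln (real n) \<le> ln x" using n by (intro ln_mono) auto
    then show "(\<Sum>p=1..n. 1 / real p) \<le> 1 + ln x" using sum_inverse_le_ln[OF n(1)] by linarith
  qed (use assms in auto)
  finally show ?thesis .
qed

section \<open>Hilbert cubes\<close>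

text \<open>Treats both forms of the cube alike. For \<open>a0 = 0\<close> the generator
  \<open>a 1\<close> becomes the base point, which makes every subsum nonempty and costs one
  index.\<close>

lemma hilbert_cube_subset_W_set:
  assumes "hilbert_cube a0 d a \<subseteq> W_set P"
  obtains I b where "I \<subseteq> {1..d}" "d \<le> card I + 1" "\<forall>J\<subseteq>I. b + sum a J \<in> W_set P"
proof -
  define ind where "ind = (\<lambda>(J :: nat set) i. if i \<in> J then 1 else 0 :: nat)"
  have sum_ind: "(\<Sum>i=1..d. ind J i * f i) = sum f J" if "J \<subseteq> {1..d}" for J f
  proof -
    have "(\<Sum>i=1..d. ind J i * f i) = (\<Sum>i=1..d. if i \<in> J then f i else 0)"
      by (intro sum.cong) (auto simp: ind_def)
    also have "\<dots> = sum f J" using that by (simp add: sum.If_cases Int_absorb1)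
    finally show ?thesis .
  qed
  have ind01: "\<forall>i\<in>{1..d}. ind J i \<in> {0, 1}" for J by (simp add: ind_def)
  consider "a0 > 0" | "a0 = 0" "d = 0" | "a0 = 0" "d > 0" by linarith
  then show thesis
  proof cases
    case 1
    show thesis
    proof (rule that[of "{1..d}" a0], goal_cases)
      case 3
      show ?case
      proof (intro allI impI)
        fix J assume J: "J \<subseteq> {1..d}"
        have "a0 + (\<Sum>i=1..d. ind J i * a i) \<in> hilbert_cube a0 d a"
          using 1 ind01[of J] unfolding hilbert_cube_def by auto
        then show "a0 + sum a J \<in> W_set P" using assms sum_ind[OF J] by auto
      qed
    qed auto
  next
    case 2
    \<comment> \<open>Here the cube is empty; the base point 1 lies in every
      \<open>W_set P\<close>.\<close>
    show thesis by (rule that[of "{}" 1]) (use 2 in \<open>auto simp: W_set_def\<close>)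
  next
    case zero: 3
    show thesis
    proof (rule that[of "{2..d}" "a 1"], goal_cases)
      case 3
      show ?case
      proof (intro allI impI)
        fix J assume J: "J \<subseteq> {2..d}"
        then have K: "insert 1 J \<subseteq> {1..d}" "1 \<notin> J" "finite J"
          using zero finite_subset[OF J] by auto
        have "(\<Sum>i=1..d. ind (insert 1 J) i) = card (insert 1 J)"
          using sum_ind[OF K(1), of "\<lambda>_. 1"] by simp
        then have "(\<Sum>i=1..d. ind (insert 1 J) i) > 0" using K by simp
        then have "(\<Sum>i=1..d. ind (insert 1 J) i * a i) \<in> hilbert_cube a0 d a"
          using zero ind01[of "insert 1 J"] unfolding hilbert_cube_def by auto
        then show "a 1 + sum a J \<in> W_set P" using assms sum_ind[OF K(1), of a] K by auto
      qed
    qed auto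
  qed
qed

text \<open>Each prime in the sum divides all but \<open>2 * p\<close> generators; weighting by
  \<open>ln p\<close> and counting by generators gives \<open>C' * (D - 2 * C * L) \<le> D\<close>,
  with \<open>D = card I\<close> and \<open>L = ln N\<close>. The second conclusion later absorbs
  the lost index.\<close>

lemma card_cube_le:
  fixes a :: "'i \<Rightarrow> nat" and C C' :: real
  assumes P: "\<And>p. p \<in> P \<Longrightarrow> prime p" and N: "N \<ge> 2" and I: "finite I" "\<And>i. i \<in> I \<Longrightarrow> a i \<in> {1..N}"
    and cube: "\<And>J. J \<subseteq> I \<Longrightarrow> b + sum a J \<in> W_set P" and C': "C' > 1"
    and sum_ge: "(\<Sum>p | p \<in> P \<and> real p \<le> C * ln (real N). ln (real p)) \<ge> C' * ln (real N)"
  shows "(C' - 1) * real (card I) \<le> 2 * C' * (C * ln (real N))" and "C * ln (real N) \<ge> 2"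
proof -
  define L where "L = ln (real N)"
  define Q where "Q = {p. p \<in> P \<and> real p \<le> C * L}"
  have L: "L > 0" using N by (simp add: L_def)
  have finQ: "finite Q"
    by (rule finite_subset[of _ "{..nat \<lfloor>C * L\<rfloor>}"]) (auto simp: Q_def le_nat_floor)
  have primeQ: "prime p" if "p \<in> Q" for p using P that by (simp add: Q_def)
  have sumQ: "C' * L \<le> (\<Sum>p\<in>Q. ln (real p))" using sum_ge by (simp add: Q_def L_def)
  have "Q \<noteq> {}" using sumQ L C' by (auto simp: mult_le_0_iff)
  then obtain q where "q \<in> Q" by blast
  then have "2 \<le> real q" "real q \<le> C * L" using primeQ prime_ge_2_nat by (auto simp: Q_def)
  then have CL: "C * L \<ge> 2" by linarith
  then show "C * ln (real N) \<ge> 2" by (simp add: L_def)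
  let ?D = "real (card I)"
  have "(C' - 1) * ?D \<le> 2 * C' * (C * L)"
  \<comment> \<open>The split makes \<open>?D - 2 * (C * L)\<close> nonnegative where
    \<open>sumQ\<close> is multiplied by it.\<close>
  proof (cases "?D \<le> 2 * (C * L)")
    case True
    have "(C' - 1) * ?D \<le> C' * ?D" by (simp add: algebra_simps)
    also have "\<dots> \<le> C' * (2 * (C * L))" using True C' by (intro mult_left_mono) auto
    finally show ?thesis by simp
  next
    case False
    have lower: "?D - 2 * (C * L) \<le> real (card {i \<in> I. p dvd a i})" if p: "p \<in> Q" for p
    proof -
      have "card {i \<in> I. \<not> int p dvd int (a i)} \<le> 2 * nat (int p)"
        by (rule card_units_le[of _ _ "int b"])
          (use primeQ[OF p] I W_set_int_square_dvd[OF cube] p in \<open>auto simp: Q_def\<close>)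
      moreover have "card I = card {i \<in> I. p dvd a i} + card {i \<in> I. \<not> p dvd a i}"
        using I by (subst card_Un_disjoint[symmetric]) (auto intro!: arg_cong[where f = card])
      ultimately show ?thesis using p by (simp add: Q_def)
    qed
    have "(C' * L) * (?D - 2 * (C * L)) \<le> (\<Sum>p\<in>Q. ln (real p)) * (?D - 2 * (C * L))"
      using sumQ False by (intro mult_right_mono) auto
    also have "\<dots> \<le> (\<Sum>p\<in>Q. ln (real p) * real (card {i \<in> I. p dvd a i}))"
      unfolding sum_distrib_right
    proof (rule sum_mono)
      fix p assume p: "p \<in> Q"
      have "ln (real p) \<ge> 0" using prime_ge_1_nat[OF primeQ[OF p]] by simp
      then show "ln (real p) * (?D - 2 * (C * L)) \<le> ln (real p) * real (card {i \<in> I. p dvd a i})"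
        using lower[OF p] by (intro mult_left_mono)
    qed
    also have "\<dots> \<le> ?D * L"
      unfolding L_def by (rule sum_ln_mult_card_dvd_le[OF finQ primeQ I])
    finally have "(C' * (?D - 2 * (C * L))) * L \<le> ?D * L" by (simp add: algebra_simps)
    then have "C' * (?D - 2 * (C * L)) \<le> ?D" using L by simp
    then show ?thesis by (simp add: algebra_simps)
  qed
  then show "(C' - 1) * ?D \<le> 2 * C' * (C * ln (real N))" by (simp add: L_def)
qed

text \<open>Gallagher's larger sieve: distinctness makes the differences nonzero, so their prime
  divisors can be counted with weight \<open>ln p\<close>, against the lower bound of
  \<open>many_congruent_pairs\<close>.\<close>

lemma card_distinct_cube_le:
  fixes a :: "'i \<Rightarrow> nat"
  assumes P: "\<And>p. p \<in> P \<Longrightarrow> prime p" and I: "finite I" "\<And>i. i \<in> I \<Longrightarrow> a i \<in> {1..N}"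
    and inj: "inj_on a I" and cube: "\<And>J. J \<subseteq> I \<Longrightarrow> b + sum a J \<in> W_set P"
    and Q: "finite Q" "Q \<subseteq> P"
    and range: "\<And>p. p \<in> Q \<Longrightarrow> card I \<le> 4 * p" "\<And>p. p \<in> Q \<Longrightarrow> 13824 * p \<le> (card I)\<^sup>2"
    and pos: "card I > 0"
  shows "real (card I) * (\<Sum>p\<in>Q. ln (real p) / real p) \<le> 13824 * ln (real N)"
proof -
  let ?D = "real (card I)"
  define Y where "Y = {(i, j) \<in> I \<times> I. i \<noteq> j}"
  define h where "h = (\<lambda>(i, j). nat \<bar>int (a i) - int (a j)\<bar>)"
  have finY: "finite Y" by (rule finite_subset[of _ "I \<times> I"]) (use I in \<open>auto simp: Y_def\<close>)
  have "card Y \<le> card (I \<times> I)" by (rule card_mono) (use I in \<open>auto simp: Y_def\<close>)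
  then have cardY: "card Y \<le> card I * card I" by (simp add: card_cartesian_product)
  from pos obtain i where "i \<in> I" by (metis all_not_in_conv card.empty less_irrefl)
  then have N: "N \<ge> 1" using I(2)[of i] by simp
  have hY: "h x \<in> {1..N}" if "x \<in> Y" for x
  proof -
    obtain i j where x: "x = (i, j)" by (cases x)
    with that have ij: "i \<in> I" "j \<in> I" "i \<noteq> j" by (simp_all add: Y_def)
    then have "a i \<noteq> a j" using inj_onD[OF inj] by blast
    moreover have "a i \<in> {1..N}" "a j \<in> {1..N}" using I(2) ij by blast+
    ultimately show ?thesis unfolding h_def x by simp linarith
  qed
  have h_dvd: "p dvd h (i, j) \<longleftrightarrow> a i mod p = a j mod p" for p i j
  proof -
    have "p dvd h (i, j) \<longleftrightarrow> int p dvd int (a i) - int (a j)"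
      by (simp add: h_def flip: int_dvd_int_iff)
    also have "\<dots> \<longleftrightarrow> int (a i) mod int p = int (a j) mod int p" by (simp add: mod_eq_dvd_iff)
    also have "\<dots> \<longleftrightarrow> a i mod p = a j mod p" by (simp flip: zmod_int)
    finally show ?thesis .
  qed
  have pairs: "?D ^ 3 * (ln (real p) / real p) \<le> 13824 * (ln (real p) * real (card {x \<in> Y. p dvd h x}))"
    if p: "p \<in> Q" for p
  proof -
    have prime: "prime p" and pP: "p \<in> P" using p P Q by auto
    have "{x \<in> Y. p dvd h x} = {(i, j) \<in> I \<times> I. i \<noteq> j \<and> a i mod p = a j mod p}"
      by (auto simp: Y_def h_dvd)
    then have "card I ^ 3 \<le> 13824 * p * card {x \<in> Y. p dvd h x}"
      using many_congruent_pairs[OF prime pP I(1) cube range[OF p]] by simp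
    then have "real (card I ^ 3) \<le> real (13824 * p * card {x \<in> Y. p dvd h x})"
      by (simp only: of_nat_le_iff)
    then have "?D ^ 3 \<le> 13824 * real p * real (card {x \<in> Y. p dvd h x})" by simp
    moreover have "real p > 0" "ln (real p) / real p \<ge> 0"
      using prime_ge_1_nat[OF prime] by auto
    ultimately have "?D ^ 3 * (ln (real p) / real p) \<le>
        13824 * real p * real (card {x \<in> Y. p dvd h x}) * (ln (real p) / real p)"
      by (intro mult_right_mono)
    then show ?thesis using \<open>real p > 0\<close> by (simp add: algebra_simps)
  qed
  have "?D ^ 3 * (\<Sum>p\<in>Q. ln (real p) / real p) \<le>
      13824 * (\<Sum>p\<in>Q. ln (real p) * real (card {x \<in> Y. p dvd h x}))"
    unfolding sum_distrib_left by (rule sum_mono[OF pairs])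
  also have "\<dots> \<le> 13824 * (real (card Y) * ln (real N))"
  proof (rule mult_left_mono)
    show "(\<Sum>p\<in>Q. ln (real p) * real (card {x \<in> Y. p dvd h x})) \<le> real (card Y) * ln (real N)"
      by (rule sum_ln_mult_card_dvd_le[OF Q(1) _ finY hY]) (use P Q(2) in auto)
  qed simp
  also have "\<dots> \<le> 13824 * ((?D * ?D) * ln (real N))"
  proof -
    have "real (card Y) \<le> ?D * ?D" using cardY by (simp flip: of_nat_mult)
    then show ?thesis using N by (intro mult_left_mono mult_right_mono) auto
  qed
  finally have "(?D * ?D) * (?D * (\<Sum>p\<in>Q. ln (real p) / real p)) \<le> (?D * ?D) * (13824 * ln (real N))"
    by (simp add: power3_eq_cube algebra_simps)
  then show ?thesis using pos by (subst (asm) mult_le_cancel_left_pos) auto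
qed

text \<open>Ensures \<open>ln (ln N) > 0\<close> for \<open>N \<ge> 3\<close>.\<close>

lemma exp_one_less_3: "exp 1 < (3::real)"
proof -
  have "1 - 1/6 \<le> exp (- 1/6 :: real)" using exp_ge_add_one_self[of "- 1/6 :: real"] by simp
  then have "exp (1/6 :: real) \<le> 6/5" by (simp add: exp_minus field_simps)
  then have "exp (1/6 :: real) ^ 6 \<le> (6/5) ^ 6" by (rule power_mono) simp
  then show ?thesis by (simp add: power_divide flip: exp_of_nat_mult)
qed

theorem theorem2p1:
  shows
    "(\<exists>c::real. c > 0 \<and>
       (\<forall>(P::nat set) (N::nat) (a0::nat) (d::nat) (a::nat \<Rightarrow> nat) (C::real) (C'::real).
          (\<forall>p\<in>P. prime p) \<longrightarrow> N \<ge> 2 \<longrightarrow>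
          (\<forall>i\<in>{1..d}. a i \<in> {1..N}) \<longrightarrow>
          hilbert_cube a0 d a \<subseteq> W_set P \<longrightarrow>
          C > 1 \<longrightarrow> C' > 1 \<longrightarrow>
          (\<Sum>p | p \<in> P \<and> real p \<le> C * ln (real N). ln (real p)) \<ge> C' * ln (real N) \<longrightarrow>
          real d \<le> c * (C * (C' + 1) / (C' - 1) * ln (real N))))
     \<and>
     (\<exists>c::real. c > 0 \<and>
       (\<forall>(P::nat set) (N::nat) (a0::nat) (d::nat) (a::nat \<Rightarrow> nat) (C::real) (C'::real).
          (\<forall>p\<in>P. prime p) \<longrightarrow> N \<ge> 3 \<longrightarrow>
          (\<forall>i\<in>{1..d}. a i \<in> {1..N}) \<longrightarrow>
          hilbert_cube a0 d a \<subseteq> W_set P \<longrightarrow>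
          inj_on a {1..d} \<longrightarrow>
          C > 0 \<longrightarrow> C' > 0 \<longrightarrow>
          (\<Sum>p | p \<in> P \<and> real p \<le> C * ln (real N). ln (real p)) > 2 * ln (real N) \<longrightarrow>
          (\<Sum>p | p \<in> P \<and> C * ln (real N) < real p \<and> real p \<le> ln (real N) powr (3/2).
              ln (real p) / real p) \<ge> C' * ln (ln (real N)) \<longrightarrow>
          real d \<le> c * (ln (real N) / (C' * ln (ln (real N))))))"
proof (intro conjI)

  \<comment> \<open>Arbitrary generators\<close>
  show "\<exists>c::real. c > 0 \<and>
       (\<forall>(P::nat set) (N::nat) (a0::nat) (d::nat) (a::nat \<Rightarrow> nat) (C::real) (C'::real).
          (\<forall>p\<in>P. prime p) \<longrightarrow> N \<ge> 2 \<longrightarrow>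
          (\<forall>i\<in>{1..d}. a i \<in> {1..N}) \<longrightarrow>
          hilbert_cube a0 d a \<subseteq> W_set P \<longrightarrow>
          C > 1 \<longrightarrow> C' > 1 \<longrightarrow>
          (\<Sum>p | p \<in> P \<and> real p \<le> C * ln (real N). ln (real p)) \<ge> C' * ln (real N) \<longrightarrow>
          real d \<le> c * (C * (C' + 1) / (C' - 1) * ln (real N)))"
  proof (intro exI[of _ 3] conjI allI impI)
    fix P :: "nat set" and N a0 d :: nat and a :: "nat \<Rightarrow> nat" and C C' :: real
    assume P: "\<forall>p\<in>P. prime p" and N: "N \<ge> 2" and a: "\<forall>i\<in>{1..d}. a i \<in> {1..N}"
      and H: "hilbert_cube a0 d a \<subseteq> W_set P" and C: "C > 1" and C': "C' > 1"
      and S: "(\<Sum>p | p \<in> P \<and> real p \<le> C * ln (real N). ln (real p)) \<ge> C' * ln (real N)"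
    obtain I b where I: "I \<subseteq> {1..d}" "d \<le> card I + 1"
      and all: "\<forall>J\<subseteq>I. b + sum a J \<in> W_set P"
      by (rule hilbert_cube_subset_W_set[OF H])
    have cube: "b + sum a J \<in> W_set P" if "J \<subseteq> I" for J using all that by blast
    have finI: "finite I" using I finite_subset by blast
    have aI: "a i \<in> {1..N}" if "i \<in> I" for i using a I that by blast
    define X where "X = C * ln (real N)"
    have bound: "(C' - 1) * real (card I) \<le> 2 * C' * X" and X: "X \<ge> 2"
      unfolding X_def using card_cube_le[OF _ N finI aI cube C' S] P by auto
    have "(C' - 1) * real d \<le> (C' - 1) * (real (card I) + 1)"
      using I(2) C' by (intro mult_left_mono) auto
    \<comment> \<open>The 1 for the lost index is absorbed into \<open>X\<close>.\<close>
    also have "\<dots> \<le> 2 * C' * X + (C' - 1) * X"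
      using bound mult_left_mono[of 1 X "C' - 1"] X C' by (simp add: algebra_simps)
    also have "\<dots> \<le> 3 * ((C' + 1) * X)" using X by (simp add: algebra_simps)
    finally have "real d \<le> 3 * ((C' + 1) * X) / (C' - 1)" using C' by (simp add: field_simps)
    also have "\<dots> = 3 * (C * (C' + 1) / (C' - 1) * ln (real N))" by (simp add: X_def)
    finally show "real d \<le> 3 * (C * (C' + 1) / (C' - 1) * ln (real N))" .
  qed simp
next

  \<comment> \<open>Distinct generators\<close>
  show "\<exists>c::real. c > 0 \<and>
       (\<forall>(P::nat set) (N::nat) (a0::nat) (d::nat) (a::nat \<Rightarrow> nat) (C::real) (C'::real).
          (\<forall>p\<in>P. prime p) \<longrightarrow> N \<ge> 3 \<longrightarrow>
          (\<forall>i\<in>{1..d}. a i \<in> {1..N}) \<longrightarrow>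
          hilbert_cube a0 d a \<subseteq> W_set P \<longrightarrow>
          inj_on a {1..d} \<longrightarrow>
          C > 0 \<longrightarrow> C' > 0 \<longrightarrow>
          (\<Sum>p | p \<in> P \<and> real p \<le> C * ln (real N). ln (real p)) > 2 * ln (real N) \<longrightarrow>
          (\<Sum>p | p \<in> P \<and> C * ln (real N) < real p \<and> real p \<le> ln (real N) powr (3/2).
              ln (real p) / real p) \<ge> C' * ln (ln (real N)) \<longrightarrow>
          real d \<le> c * (ln (real N) / (C' * ln (ln (real N)))))"
  \<comment> \<open>Twice 13824, the factor two paying for
    \<open>d \<le> 2 * card I\<close>.\<close>
  proof (intro exI[of _ 27648] conjI allI impI)
    fix P :: "nat set" and N a0 d :: nat and a :: "nat \<Rightarrow> nat" and C C' :: real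
    assume P: "\<forall>p\<in>P. prime p" and N: "N \<ge> 3" and a: "\<forall>i\<in>{1..d}. a i \<in> {1..N}"
      and H: "hilbert_cube a0 d a \<subseteq> W_set P" and inj: "inj_on a {1..d}" and C: "C > 0" and C': "C' > 0"
      and S: "(\<Sum>p | p \<in> P \<and> real p \<le> C * ln (real N). ln (real p)) > 2 * ln (real N)"
      and S': "(\<Sum>p | p \<in> P \<and> C * ln (real N) < real p \<and> real p \<le> ln (real N) powr (3/2).
              ln (real p) / real p) \<ge> C' * ln (ln (real N))"
    obtain I b where I: "I \<subseteq> {1..d}" "d \<le> card I + 1"
      and all: "\<forall>J\<subseteq>I. b + sum a J \<in> W_set P"
      by (rule hilbert_cube_subset_W_set[OF H])
    have cube: "b + sum a J \<in> W_set P" if "J \<subseteq> I" for J using all that by blast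
    have finI: "finite I" using I finite_subset by blast
    have aI: "a i \<in> {1..N}" if "i \<in> I" for i using a I that by blast
    have injI: "inj_on a I" using inj I inj_on_subset by blast
    define L where "L = ln (real N)"
    define Q where "Q = {p. p \<in> P \<and> C * L < real p \<and> real p \<le> L powr (3/2)}"
    have "exp 1 < real N" using exp_one_less_3 N by linarith
    then have "ln (exp 1) < L" unfolding L_def using N by (subst ln_less_cancel_iff) auto
    then have L1: "L > 1" by simp
    then have lnL: "ln L > 0" by simp
    have finQ: "finite Q"
      by (rule finite_subset[of _ "{..nat \<lfloor>L powr (3/2)\<rfloor>}"]) (auto simp: Q_def le_nat_floor)
    have SQ: "C' * ln L \<le> (\<Sum>p\<in>Q. ln (real p) / real p)" using S' by (simp add: Q_def L_def)
    let ?D = "real (card I)"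
    \<comment> \<open>The estimate behind (a) with \<open>C' = 2\<close>; it yields
      \<open>card I \<le> 4 * p\<close> for every \<open>p\<close> in \<open>Q\<close>.\<close>
    have "(2 - 1) * ?D \<le> 2 * 2 * (C * ln (real N))"
      using card_cube_le(1)[of P N I a b 2 C] P N finI aI cube S by auto
    then have D: "?D \<le> 4 * (C * L)" by (simp add: L_def)
    have d: "real d \<le> ?D + 1" using I(2) by simp
    have "real d * (C' * ln L) \<le> 27648 * L"
    \<comment> \<open>The larger sieve needs \<open>13824 * p \<le> (card I)\<^sup>2\<close> up to
      \<open>p = L powr (3/2)\<close>.\<close>
    proof (cases "13824 * L powr (3/2) \<le> ?D\<^sup>2")
      case True
      have "L powr (3/2) > 0" using L1 by simp
      then have D0: "card I > 0" using True by (cases "card I = 0") auto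
      have "?D * (\<Sum>p\<in>Q. ln (real p) / real p) \<le> 13824 * ln (real N)"
      proof (rule card_distinct_cube_le[OF _ finI aI injI cube finQ _ _ _ D0])
        show "Q \<subseteq> P" by (auto simp: Q_def)
        show "card I \<le> 4 * p" if "p \<in> Q" for p
        proof -
          have "?D \<le> real (4 * p)" using D that by (simp add: Q_def)
          then show ?thesis by (simp only: of_nat_le_iff)
        qed
        show "13824 * p \<le> (card I)\<^sup>2" if "p \<in> Q" for p
        proof -
          have "real (13824 * p) \<le> real ((card I)\<^sup>2)" using True that by (simp add: Q_def)
          then show ?thesis by (simp only: of_nat_le_iff)
        qed
      qed (use P in auto)
      moreover have "?D * (C' * ln L) \<le> ?D * (\<Sum>p\<in>Q. ln (real p) / real p)"
        by (rule mult_left_mono[OF SQ]) simp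
      ultimately have "?D * (C' * ln L) \<le> 13824 * L" by (simp add: L_def)
      moreover have "real d * (C' * ln L) \<le> (2 * ?D) * (C' * ln L)"
        using d D0 C' lnL by (intro mult_right_mono) auto
      ultimately show ?thesis by simp
    next
      case False
      \<comment> \<open>Now \<open>d\<close> is at most of order \<open>L powr (3/4)\<close>, that
        is \<open>y ^ 6\<close>, and \<open>ln L \<le> 8 * y\<close>; a bound of order
        \<open>y\<^sup>2\<close> for \<open>C' * ln L\<close> then gives
        \<open>y ^ 8 = L\<close>.\<close>
      define y where "y = L powr (1/8)"
      have y1: "y \<ge> 1" using L1 by (simp add: y_def ge_one_powr_ge_zero)
      have pow: "y ^ k = L powr (real k / 8)" for k
        using L1 by (simp add: y_def powr_powr flip: powr_realpow)
      have y8: "y ^ 8 = L" using pow[of 8] L1 by simp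
      have y12: "y ^ 12 = L powr (3/2)" using pow[of 12] by simp
      have "?D\<^sup>2 < 13824 * y ^ 12" using False y12 by simp
      \<comment> \<open>The square of 118 is 13924.\<close>
      also have "\<dots> \<le> (118 * y ^ 6)\<^sup>2" using y1 by (simp add: power_mult_distrib flip: power_mult)
      finally have "?D < 118 * y ^ 6" by (rule power_less_imp_less_base) (use y1 in simp)
      moreover have "1 \<le> y ^ 6" using y1 by simp
      ultimately have d6: "real d \<le> 119 * y ^ 6" using d by linarith
      have ln_y: "ln L \<le> 8 * y" using ln_powr_bound[of L "1/8"] L1 by (simp add: y_def)
      \<comment> \<open>The hypothesis itself keeps \<open>C'\<close> from being large.\<close>
      have "(\<Sum>p\<in>Q. ln (real p) / real p) \<le> ln (L powr (3/2)) * (1 + ln (L powr (3/2)))"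
      proof (rule sum_ln_over_le)
        show "p \<ge> 1 \<and> real p \<le> L powr (3/2)" if "p \<in> Q" for p
          using that P prime_ge_1_nat[of p] by (simp add: Q_def)
      qed (use L1 in \<open>simp add: ge_one_powr_ge_zero\<close>)
      with SQ have "C' * ln L \<le> ln (L powr (3/2)) * (1 + ln (L powr (3/2)))" by linarith
      also have "ln (L powr (3/2)) = 3/2 * ln L" using L1 by (simp add: ln_powr)
      also have "3/2 * ln L * (1 + 3/2 * ln L) \<le> (12 * y) * (13 * y)"
        by (rule mult_mono; use ln_y lnL y1 in linarith)
      finally have "C' * ln L \<le> 156 * y\<^sup>2" by (simp add: power2_eq_square)
      then have "real d * (C' * ln L) \<le> (119 * y ^ 6) * (156 * y\<^sup>2)"
        by (rule mult_mono[OF d6]) (use C' lnL y1 in auto)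
      also have "\<dots> = 18564 * y ^ 8" by (simp flip: power_add)
      also have "\<dots> \<le> 27648 * L" using y8 L1 by simp
      finally show ?thesis .
    qed
    then have "real d \<le> 27648 * L / (C' * ln L)" using C' lnL by (simp add: pos_le_divide_eq)
    then show "real d \<le> 27648 * (ln (real N) / (C' * ln (ln (real N))))" by (simp add: L_def)
  qed simp
qed

end
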